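(* Let $\mathcal H,\widetilde{\mathcal H}$ be Hilbert spaces, let $\mathfrak a,\widetilde{\mathfrak a}$ be closed, densely defined, non-negative sesquilinear forms in $\mathcal H$ and $\widetilde{\mathcal H}$ respectively, let $\mathcal A,\widetilde{\mathcal A}$ be the associated non-negative self-adjoint operators, assumed to be unbounded, and let $\mathcal R=(\mathcal A+\mathrm I)^{-1}$, $\widetilde{\mathcal R}=(\widetilde{\mathcal A}+\mathrm I)^{-1}$. Let $\mathcal J:\mathcal H\to\widetilde{\mathcal H}$ and $\widetilde{\mathcal J}:\widetilde{\mathcal H}\to\mathcal H$ be bounded linear operators satisfying $$\|\widetilde{\mathcal R}\mathcal J-\mathcal J\mathcal R\|_{\mathcal H\to\widetilde{\mathcal H}}\le\eta,\qquad \|\widetilde{\mathcal J}\widetilde{\mathcal R}-\mathcal R\widetilde{\mathcal J}\|_{\widetilde{\mathcal H}\to\mathcal H}\le\widetilde\eta,$$ and, moreover, $$\|f\|_{\mathcal H}^2\le\mu\|\mathcal Jf\|_{\widetilde{\mathcal H}}^2+\nu\,\mathfrak a[f,f]\quad\forall f\in\operatorname{dom}(\mathfrak a),$$ $$\|u\|_{\widetilde{\mathcal H}}^2\le\widetilde\mu\|\widetilde{\mathcal J}u\|_{\mathcal H}^2+\widetilde\nu\,\widetilde{\mathfrak a}[u,u]\quad\forall u\in\operatorname{dom}(\widetilde{\mathfrak a}),$$ for some positive constants $\eta,\mu,\nu,\widetilde\eta,\widetilde\mu,\widetilde\nu$. Then for any $\kappa,\widetilde\kappa\in(0,1)$ $$d_{\mathrm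 H}\bigl(\sigma(\mathcal R),\sigma(\widetilde{\mathcal R})\bigr)\le\max\left\{\eta\sqrt{\frac{\mu}{\kappa}};\ \frac{\nu}{1-\kappa};\ \widetilde\eta\sqrt{\frac{\widetilde\mu}{\widetilde\kappa}};\ \frac{\widetilde\nu}{1-\widetilde\kappa}\right\}.$$
   Context: For closed sets $X,Y\subset\mathbb R$, the Hausdorff distance is $d_{\mathrm H}(X,Y)=\max\{\sup_{x\in X}\inf_{y\in Y}|x-y|;\ \sup_{y\in Y}\inf_{x\in X}|y-x|\}$. $\|\cdot\|_{X\to Y}$ denotes the operator norm. Unboundedness of $\mathcal A$ and $\widetilde{\mathcal A}$ ensures $0\in\sigma(\mathcal R)\cap\sigma(\widetilde{\mathcal R})$. *)

theory Defs
  imports "HOL-Analysis.Analysis"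
begin

text \<open>
  Complex Hilbert spaces are types of a class extending \<open>banach\<close>. The inner product is linear
  in the first and antilinear in the second argument. Positive definiteness is contained in
  the axiom tying it to the norm.
\<close>

class chilbert_space = banach +
  fixes scaleC :: "complex \<Rightarrow> 'a \<Rightarrow> 'a" (infixr "*\<^sub>C" 75)
    and cinner :: "'a \<Rightarrow> 'a \<Rightarrow> complex"
  assumes scaleC_of_real: "complex_of_real r *\<^sub>C x = r *\<^sub>R x"
    and scaleC_add_right: "c *\<^sub>C (x + y) = c *\<^sub>C x + c *\<^sub>C y"
    and scaleC_add_left: "(c + d) *\<^sub>C x = c *\<^sub>C x + d *\<^sub>C x"
    and scaleC_scaleC: "c *\<^sub>C d *\<^sub>C x = (c * d) *\<^sub>C x"
    and cinner_add_left: "cinner (x + y) z = cinner x z + cinner y z"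
    and cinner_scaleC_left: "cinner (c *\<^sub>C x) y = c * cinner x y"
    and cinner_commute: "cinner x y = cnj (cinner y x)"
    and cinner_self: "cinner x x = complex_of_real ((norm x)\<^sup>2)"

definition bounded_clinear :: "('a::chilbert_space \<Rightarrow> 'b::chilbert_space) \<Rightarrow> bool" where
  "bounded_clinear T \<longleftrightarrow> bounded_linear T \<and> (\<forall>c x. T (c *\<^sub>C x) = c *\<^sub>C T x)"

definition csubspace :: "'a::chilbert_space set \<Rightarrow> bool" where
  "csubspace D \<longleftrightarrow> 0 \<in> D \<and> (\<forall>x\<in>D. \<forall>y\<in>D. x + y \<in> D) \<and> (\<forall>c. \<forall>x\<in>D. c *\<^sub>C x \<in> D)"

text \<open>
  A form is given by its domain \<open>D\<close> together with a function \<open>a\<close> that is only relevant on \<open>D\<close>.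
\<close>

definition sesquilinear_form :: "'a::chilbert_space set \<Rightarrow> ('a \<Rightarrow> 'a \<Rightarrow> complex) \<Rightarrow> bool" where
  "sesquilinear_form D a \<longleftrightarrow> csubspace D \<and>
     (\<forall>f\<in>D. \<forall>g\<in>D. \<forall>h\<in>D. a (f + g) h = a f h + a g h \<and> a h (f + g) = a h f + a h g) \<and>
     (\<forall>c. \<forall>f\<in>D. \<forall>g\<in>D. a (c *\<^sub>C f) g = c * a f g \<and> a f (c *\<^sub>C g) = cnj c * a f g)"

definition densely_defined :: "'a::chilbert_space set \<Rightarrow> bool" where
  "densely_defined D \<longleftrightarrow> closure D = UNIV"

definition nonneg_form :: "'a::chilbert_space set \<Rightarrow> ('a \<Rightarrow> 'a \<Rightarrow> complex) \<Rightarrow> bool" where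
  "nonneg_form D a \<longleftrightarrow> (\<forall>f\<in>D. a f f \<in> \<real> \<and> 0 \<le> Re (a f f))"

text \<open>
  Closedness in the sense of Kato: if \<open>u n \<in> D\<close>, \<open>u n\<close> converges to \<open>f\<close> in the Hilbert space and
  \<open>a[u m - u n, u m - u n]\<close> tends to 0 as \<open>m\<close> and \<open>n\<close> tend to infinity, then \<open>f \<in> D\<close> and
  \<open>a[u n - f, u n - f]\<close> tends to 0.
\<close>

definition closed_form :: "'a::chilbert_space set \<Rightarrow> ('a \<Rightarrow> 'a \<Rightarrow> complex) \<Rightarrow> bool" where
  "closed_form D a \<longleftrightarrow>
     (\<forall>u f. (\<forall>n::nat. u n \<in> D) \<longrightarrow> u \<longlonglongrightarrow> f \<longrightarrow>
        (\<forall>e>0. \<exists>N. \<forall>m\<ge>N. \<forall>n\<ge>N. cmod (a (u m - u n) (u m - u n)) < e) \<longrightarrow>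
        f \<in> D \<and> (\<lambda>n. a (u n - f) (u n - f)) \<longlonglongrightarrow> 0)"

text \<open>
  The operator \<open>A\<close> associated with a form: \<open>f \<in> dom A\<close> and \<open>A f = h\<close> iff \<open>f \<in> D\<close> and
  \<open>a[f, g] = (h, g)\<close> for all \<open>g \<in> D\<close>. The vector \<open>h\<close> is unique when \<open>D\<close> is dense.
\<close>

definition assoc_dom :: "'a::chilbert_space set \<Rightarrow> ('a \<Rightarrow> 'a \<Rightarrow> complex) \<Rightarrow> 'a set" where
  "assoc_dom D a = {f \<in> D. \<exists>h. \<forall>g\<in>D. a f g = cinner h g}"

definition assoc_op :: "'a::chilbert_space set \<Rightarrow> ('a \<Rightarrow> 'a \<Rightarrow> complex) \<Rightarrow> 'a \<Rightarrow> 'a" where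
  "assoc_op D a f = (THE h. \<forall>g\<in>D. a f g = cinner h g)"

definition unbounded_on :: "'a::chilbert_space set \<Rightarrow> ('a \<Rightarrow> 'a) \<Rightarrow> bool" where
  "unbounded_on E A \<longleftrightarrow> \<not> (\<exists>C. \<forall>f\<in>E. norm (A f) \<le> C * norm f)"

text \<open>
  \<open>(A + I)\<inverse>\<close>. For a densely defined closed non-negative form, \<open>A + I\<close> maps \<open>dom A\<close> bijectively
  onto the whole space, so this is an everywhere defined bounded operator.
\<close>

definition resolvent :: "'a::chilbert_space set \<Rightarrow> ('a \<Rightarrow> 'a \<Rightarrow> complex) \<Rightarrow> 'a \<Rightarrow> 'a" where
  "resolvent D a = inv_into (assoc_dom D a) (\<lambda>f. assoc_op D a f + f)"

text \<open>The spectrum of an everywhere defined operator, as a subset of the complex plane.\<close>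

definition spectrum :: "('a::chilbert_space \<Rightarrow> 'a) \<Rightarrow> complex set" where
  "spectrum T = {z. \<not> (\<exists>S. bounded_clinear S \<and>
     (\<forall>x. S (T x - z *\<^sub>C x) = x) \<and> (\<forall>x. T (S x) - z *\<^sub>C S x = x))}"

text \<open>
  The Hausdorff distance, with values in \<open>[0, \<infinity>]\<close> so that suprema and infima always exist.
  It is stated for arbitrary metric spaces because \<open>spectrum\<close> is a set of complex numbers;
  for sets of real numbers regarded as complex numbers it is the distance on the real line.
\<close>

definition hausdorff_dist :: "'a::metric_space set \<Rightarrow> 'a set \<Rightarrow> ennreal" where
  "hausdorff_dist X Y =
     max (SUP x\<in>X. INF y\<in>Y. ennreal (dist x y)) (SUP y\<in>Y. INF x\<in>X. ennreal (dist y x))"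

end

theory Submission
  imports Defs
begin

text \<open>
  The distance from a real \<open>r\<close> to the spectrum of a self-adjoint \<open>T\<close> is at most \<open>\<parallel>T u - r u\<parallel> / \<parallel>u\<parallel>\<close>
  for every \<open>u \<noteq> 0\<close>. Take \<open>r\<close> in the spectrum of \<open>R\<close>. If \<open>r \<le> \<nu> / (1 - \<kappa>)\<close>, then \<open>0\<close>, which lies in the
  spectrum of \<open>R'\<close> by unboundedness, is close enough to \<open>r\<close>. Otherwise let \<open>g\<close> be an approximate
  eigenvector of \<open>R\<close> for \<open>r\<close> in the form domain. As \<open>R' J g - r J g = (R' J - J R) g + J (R g - r g)\<close>,
  the commutator bound makes the norm of this vector essentially at most \<open>\<eta> \<parallel>g\<parallel>\<close>, and the lower
  bound for \<open>J\<close> gives \<open>\<parallel>g\<parallel> \<le> sqrt (\<mu> / \<kappa>) \<parallel>J g\<parallel>\<close> up to an arbitrarily small error.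
\<close>

section \<open>Complex inner products\<close>

lemma scaleC_minus1: "(-1) *\<^sub>C x = - (x::'a::chilbert_space)"
  using scaleC_of_real[of "-1" x] by simp

lemma scaleC_zero_right [simp]: "c *\<^sub>C (0::'a::chilbert_space) = 0"
  using scaleC_add_right[of c 0 "0::'a"] by simp

lemma scaleC_zero_left [simp]: "0 *\<^sub>C x = (0::'a::chilbert_space)"
  using scaleC_of_real[of 0 x] by simp

lemma scaleC_minus_right [simp]: "c *\<^sub>C (- x) = - (c *\<^sub>C (x::'a::chilbert_space))"
  using scaleC_add_right[of c x "- x"] by (simp add: eq_neg_iff_add_eq_0 add.commute)

lemma scaleC_diff_right: "c *\<^sub>C (x - y) = c *\<^sub>C x - c *\<^sub>C (y::'a::chilbert_space)"
  using scaleC_add_right[of c x "- y"] by simp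

lemma cinner_add_right: "cinner x (y + z) = cinner x y + cinner (x::'a::chilbert_space) z"
  by (metis cinner_add_left cinner_commute complex_cnj_add)

lemma cinner_scaleC_right: "cinner x (c *\<^sub>C y) = cnj c * cinner (x::'a::chilbert_space) y"
  by (metis cinner_commute cinner_scaleC_left complex_cnj_mult)

lemma cinner_minus_left: "cinner (- x) y = - cinner (x::'a::chilbert_space) y"
  using cinner_scaleC_left[of "-1" x y] by (simp add: scaleC_minus1)

lemma cinner_minus_right: "cinner x (- y) = - cinner (x::'a::chilbert_space) y"
  using cinner_scaleC_right[of x "-1" y] by (simp add: scaleC_minus1)

lemma cinner_diff_left: "cinner (x - y) z = cinner x z - cinner (y::'a::chilbert_space) z"
  using cinner_add_left[of x "- y" z] by (simp add: cinner_minus_left)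

lemma cinner_diff_right: "cinner x (y - z) = cinner x y - cinner (x::'a::chilbert_space) z"
  using cinner_add_right[of x y "- z"] by (simp add: cinner_minus_right)

lemma cinner_scaleR_left: "cinner (r *\<^sub>R x) y = of_real r * cinner (x::'a::chilbert_space) y"
  by (metis cinner_scaleC_left scaleC_of_real)

lemma cinner_scaleR_right: "cinner x (r *\<^sub>R y) = of_real r * cinner (x::'a::chilbert_space) y"
  by (metis cinner_scaleC_right complex_cnj_complex_of_real scaleC_of_real)

lemma Re_cinner_commute: "Re (cinner x y) = Re (cinner (y::'a::chilbert_space) x)"
  by (subst cinner_commute) simp

lemma norm_add_sq:
  "(norm (x + y))\<^sup>2 = (norm x)\<^sup>2 + 2 * Re (cinner x y) + (norm (y::'a::chilbert_space))\<^sup>2"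
proof -
  have "(norm (x + y))\<^sup>2 = Re (cinner (x + y) (x + y))"
    by (simp only: cinner_self Re_complex_of_real)
  also have "\<dots> = Re (cinner x x) + 2 * Re (cinner x y) + Re (cinner y y)"
    by (simp add: cinner_add_left cinner_add_right Re_cinner_commute[of y x])
  finally show ?thesis
    by (simp only: cinner_self Re_complex_of_real)
qed

lemma norm_diff_sq:
  "(norm (x - y))\<^sup>2 = (norm x)\<^sup>2 - 2 * Re (cinner x y) + (norm (y::'a::chilbert_space))\<^sup>2"
  using norm_add_sq[of x "- y"] by (simp add: cinner_minus_right)

text \<open>Cauchy-Schwarz is read off from the triangle inequality, which a normed space already
  provides, by squaring both sides.\<close>

lemma Re_cinner_le: "Re (cinner x y) \<le> norm x * norm (y::'a::chilbert_space)"
proof -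
  have "(norm (x + y))\<^sup>2 \<le> (norm x + norm y)\<^sup>2"
    by (intro power_mono norm_triangle_ineq) simp
  then show ?thesis
    by (simp add: norm_add_sq power2_sum)
qed

lemma abs_Re_cinner_le: "\<bar>Re (cinner x y)\<bar> \<le> norm x * norm (y::'a::chilbert_space)"
  using Re_cinner_le[of x y] Re_cinner_le[of "- x" y] by (auto simp: cinner_minus_left)

lemma norm_scaleC [simp]: "norm (c *\<^sub>C x) = cmod c * norm (x::'a::chilbert_space)"
proof -
  have "complex_of_real ((norm (c *\<^sub>C x))\<^sup>2) = complex_of_real ((cmod c * norm x)\<^sup>2)"
    unfolding cinner_self[symmetric] cinner_scaleC_left cinner_scaleC_right
    by (simp add: cinner_self power_mult_distrib mult.assoc[symmetric] complex_norm_square[symmetric]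
        mult.commute[of "cnj c"])
  then have "(norm (c *\<^sub>C x))\<^sup>2 = (cmod c * norm x)\<^sup>2"
    by (simp only: of_real_eq_iff)
  then show ?thesis
    by (simp add: power2_eq_iff_nonneg)
qed

lemma abs_Im_cinner_le: "\<bar>Im (cinner x y)\<bar> \<le> norm x * norm (y::'a::chilbert_space)"
  using abs_Re_cinner_le[of "\<i> *\<^sub>C x" y] by (simp add: cinner_scaleC_left)

text \<open>If k were nonzero, some g in D would lie closer to k than \<open>norm k\<close>;
  subtracting it in the second argument does not change (k, k), which then falls below its own
  value.\<close>

lemma cinner_eq_zero_dense:
  fixes k :: "'a::chilbert_space"
  assumes "densely_defined D" and "\<And>g. g \<in> D \<Longrightarrow> cinner k g = 0"
  shows "k = 0"
proof (rule ccontr)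
  assume "k \<noteq> 0"
  have "k \<in> closure D"
    using assms(1) by (simp add: densely_defined_def)
  then obtain g where g: "g \<in> D" "dist g k < norm k"
    using \<open>k \<noteq> 0\<close> unfolding closure_approachable by (meson zero_less_norm_iff)
  have "(norm k)\<^sup>2 = Re (cinner k (k - g))"
    using assms(2)[OF g(1)] by (simp add: cinner_diff_right cinner_self)
  also have "\<dots> \<le> norm k * norm (k - g)"
    by (rule Re_cinner_le)
  also have "\<dots> < norm k * norm k"
    using g \<open>k \<noteq> 0\<close> by (simp add: dist_norm norm_minus_commute)
  finally show False
    by (simp add: power2_eq_square)
qed

lemma cinner_ext:
  fixes h k :: "'a::chilbert_space"
  assumes "densely_defined D" and "\<And>g. g \<in> D \<Longrightarrow> cinner h g = cinner k g"
  shows "h = k"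
  using cinner_eq_zero_dense[OF assms(1), of "h - k"] assms(2) by (simp add: cinner_diff_left)

lemma densely_defined_UNIV: "densely_defined UNIV"
  by (simp add: densely_defined_def)

section \<open>The resolvent of a closed non-negative form\<close>

text \<open>For small t the linear term dominates and would change sign. This is the first-order
  condition at the minimiser below.\<close>

lemma quadratic_nonneg_imp_linear_zero:
  fixes b c :: real
  assumes "\<And>t. 0 \<le> 2 * t * b + t\<^sup>2 * c"
  shows "b = 0"
proof (rule ccontr)
  assume "b \<noteq> 0"
  \<comment> \<open>A strictly positive upper bound of c, so that t = -b / d is defined and gives at
    most -b^2 / d.\<close>
  define d where "d = \<bar>c\<bar> + 1"
  have "0 < d" "c \<le> d"
    by (auto simp: d_def)
  have "0 \<le> 2 * (- b / d) * b + (- b / d)\<^sup>2 * c"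
    by (rule assms)
  also have "\<dots> \<le> 2 * (- b / d) * b + (- b / d)\<^sup>2 * d"
    by (intro add_left_mono mult_left_mono \<open>c \<le> d\<close>) simp
  also have "\<dots> = - b\<^sup>2 / d"
    using \<open>0 < d\<close> by (simp add: power2_eq_square field_simps)
  also have "\<dots> < 0"
    using \<open>b \<noteq> 0\<close> \<open>0 < d\<close> by simp
  finally show False by simp
qed

text \<open>Besides the two given forms, the locale is instantiated with a bounded form on the whole
  space, which turns the existence result for forms into surjectivity of shifted self-adjoint
  operators.\<close>

locale nonneg_closed_form =
  fixes D :: "'a::chilbert_space set" and a :: "'a \<Rightarrow> 'a \<Rightarrow> complex"
  assumes sesquilinear: "sesquilinear_form D a" and dense: "densely_defined D"
    and nonneg: "nonneg_form D a" and closed: "closed_form D a"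
begin

section \<open>Algebra of the form and its Cauchy-Schwarz inequality\<close>

lemma zero_mem: "0 \<in> D"
  and add_mem: "f \<in> D \<Longrightarrow> g \<in> D \<Longrightarrow> f + g \<in> D"
  and scaleC_mem: "f \<in> D \<Longrightarrow> c *\<^sub>C f \<in> D"
  using sesquilinear by (auto simp: sesquilinear_form_def csubspace_def)

lemma scaleR_mem: "f \<in> D \<Longrightarrow> r *\<^sub>R f \<in> D"
  by (metis scaleC_mem scaleC_of_real)

lemma diff_mem: "f \<in> D \<Longrightarrow> g \<in> D \<Longrightarrow> f - g \<in> D"
  using add_mem[of f "- g"] scaleC_mem[of g "-1"] by (simp add: scaleC_minus1)

lemma form_add_left: "\<lbrakk>f \<in> D; g \<in> D; h \<in> D\<rbrakk> \<Longrightarrow> a (f + g) h = a f h + a g h"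
  and form_add_right: "\<lbrakk>f \<in> D; g \<in> D; h \<in> D\<rbrakk> \<Longrightarrow> a h (f + g) = a h f + a h g"
  and form_scaleC_left: "\<lbrakk>f \<in> D; g \<in> D\<rbrakk> \<Longrightarrow> a (c *\<^sub>C f) g = c * a f g"
  and form_scaleC_right: "\<lbrakk>f \<in> D; g \<in> D\<rbrakk> \<Longrightarrow> a f (c *\<^sub>C g) = cnj c * a f g"
  using sesquilinear by (auto simp: sesquilinear_form_def)

lemma form_scaleR_left: "\<lbrakk>f \<in> D; g \<in> D\<rbrakk> \<Longrightarrow> a (r *\<^sub>R f) g = of_real r * a f g"
  by (metis form_scaleC_left scaleC_of_real)

lemma form_scaleR_right: "\<lbrakk>f \<in> D; g \<in> D\<rbrakk> \<Longrightarrow> a f (r *\<^sub>R g) = of_real r * a f g"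
  by (metis form_scaleC_right complex_cnj_complex_of_real scaleC_of_real)

lemma form_diff_left: "\<lbrakk>f \<in> D; g \<in> D; h \<in> D\<rbrakk> \<Longrightarrow> a (f - g) h = a f h - a g h"
  using form_add_left[of f "- g" h] form_scaleC_left[of g h "-1"] scaleC_mem[of g "-1"]
  by (simp add: scaleC_minus1)

lemma form_diff_right: "\<lbrakk>f \<in> D; g \<in> D; h \<in> D\<rbrakk> \<Longrightarrow> a h (f - g) = a h f - a h g"
  using form_add_right[of f "- g" h] form_scaleC_right[of h g "-1"] scaleC_mem[of g "-1"]
  by (simp add: scaleC_minus1)

lemma form_self_nonneg: "f \<in> D \<Longrightarrow> 0 \<le> Re (a f f)"
  and form_self_Im: "f \<in> D \<Longrightarrow> Im (a f f) = 0"
  using nonneg by (auto simp: nonneg_form_def complex_is_Real_iff)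

text \<open>Polarization: reality of the form at f + g settles the imaginary part, reality at f + ig
  the real part.\<close>

lemma form_hermitian:
  assumes "f \<in> D" "g \<in> D"
  shows "a f g = cnj (a g f)"
proof (rule complex_eqI)
  show "Im (a f g) = Im (cnj (a g f))"
    using form_self_Im[of "f + g"] form_self_Im[of f] form_self_Im[of g] assms
    by (simp add: form_add_left form_add_right add_mem)
  show "Re (a f g) = Re (cnj (a g f))"
    using form_self_Im[of "f + \<i> *\<^sub>C g"] form_self_Im[of f] form_self_Im[of g] assms
    by (simp add: form_add_left form_add_right form_scaleC_left form_scaleC_right add_mem scaleC_mem)
qed

lemma Re_form_commute: "\<lbrakk>f \<in> D; g \<in> D\<rbrakk> \<Longrightarrow> Re (a f g) = Re (a g f)"
  by (subst form_hermitian) auto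

lemma Re_form_add:
  "\<lbrakk>f \<in> D; g \<in> D\<rbrakk> \<Longrightarrow> Re (a (f + g) (f + g)) = Re (a f f) + 2 * Re (a f g) + Re (a g g)"
  by (simp add: form_add_left form_add_right add_mem Re_form_commute[of g f])

lemma Re_form_diff:
  "\<lbrakk>f \<in> D; g \<in> D\<rbrakk> \<Longrightarrow> Re (a (f - g) (f - g)) = Re (a f f) - 2 * Re (a f g) + Re (a g g)"
  by (simp add: form_diff_left form_diff_right diff_mem Re_form_commute[of g f])

lemma form_Cauchy_Schwarz:
  assumes "f \<in> D" "g \<in> D"
  shows "(Re (a f g))\<^sup>2 \<le> Re (a f f) * Re (a g g)"
proof -
  have q: "0 \<le> Re (a f f) + 2 * t * Re (a f g) + t\<^sup>2 * Re (a g g)" for t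
    using form_self_nonneg[of "f + t *\<^sub>R g"] assms
    by (simp add: Re_form_add add_mem scaleR_mem form_scaleR_left form_scaleR_right
        power2_eq_square mult.assoc)
  show ?thesis
  proof (cases "Re (a g g) = 0")
    case True
    have "Re (a f g) = 0"
    proof (rule ccontr)
      assume "Re (a f g) \<noteq> 0"
      then show False
        \<comment> \<open>With a[g, g] = 0 the quadratic in \<open>q\<close> is affine in t, and
          this t makes it equal to -1.\<close>
        using q[of "- (Re (a f f) + 1) / (2 * Re (a f g))"] True \<open>Re (a f g) \<noteq> 0\<close>
          by (simp add: field_simps)
    qed
    then show ?thesis using True by simp
  next
    case False
    then have "Re (a g g) > 0"
      using form_self_nonneg[OF assms(2)] by simp
    then show ?thesis
      using q[of "- Re (a f g) / Re (a g g)"] by (simp add: field_simps power2_eq_square)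
  qed
qed

text \<open>Cauchy-Schwarz applied to \<open>u n - f\<close> and g. It lets the weak equation pass
  to the limit of a minimising sequence.\<close>

lemma form_tendsto_left:
  assumes "\<And>n. u n \<in> D" "f \<in> D" "g \<in> D" and lim: "(\<lambda>n::nat. a (u n - f) (u n - f)) \<longlonglongrightarrow> 0"
  shows "(\<lambda>n. Re (a (u n) g)) \<longlonglongrightarrow> Re (a f g)"
proof -
  have "(\<lambda>n. sqrt (Re (a (u n - f) (u n - f)) * Re (a g g))) \<longlonglongrightarrow> sqrt (Re 0 * Re (a g g))"
    by (intro tendsto_intros lim)
  then have "(\<lambda>n. sqrt (Re (a (u n - f) (u n - f)) * Re (a g g))) \<longlonglongrightarrow> 0"
    by simp
  then have "(\<lambda>n. Re (a (u n) g) - Re (a f g)) \<longlonglongrightarrow> 0"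
  proof (rule Lim_null_comparison[rotated])
    show "\<forall>\<^sub>F n in sequentially. norm (Re (a (u n) g) - Re (a f g))
        \<le> sqrt (Re (a (u n - f) (u n - f)) * Re (a g g))"
      using form_Cauchy_Schwarz[of "u _ - f" g] assms
      by (intro always_eventually allI)
        (simp add: real_le_rsqrt form_diff_left diff_mem)
  qed
  then show ?thesis
    by (simp add: LIM_zero_iff)
qed

text \<open>The solution minimises the functional \<open>q[f, f] - 2 Re (h, f)\<close>, where \<open>q = a + l (\<cdot>, \<cdot>)\<close>:
  a minimising sequence is Cauchy by the parallelogram law, and closedness supplies its limit.\<close>

lemma weak_solution_exists:
  assumes l: "0 < l"
  obtains f where "f \<in> D" "\<And>g. g \<in> D \<Longrightarrow> a f g + of_real l * cinner f g = cinner h g"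
proof -
  \<comment> \<open>\<open>N\<close> is the quadratic form of q. \<open>L f g\<close> is the real
    part of the defect in the weak equation, and also half the derivative of \<open>Q\<close> at f
    in direction g.\<close>
  define N where "N f = Re (a f f) + l * (norm f)\<^sup>2" for f
  define L where "L f g = Re (a f g) + l * Re (cinner f g) - Re (cinner h g)" for f g
  define Q where "Q f = N f - 2 * Re (cinner h f)" for f
  have Q_add: "Q (f + g) = Q f + 2 * L f g + N g" if "f \<in> D" "g \<in> D" for f g
    using that by (simp add: Q_def N_def L_def Re_form_add norm_add_sq cinner_add_right algebra_simps)
  have Q_lower: "- (norm h)\<^sup>2 / l \<le> Q f" if "f \<in> D" for f
  proof -
    have "0 \<le> l * (norm f - norm h / l)\<^sup>2"
      using l by simp
    also have "\<dots> = l * (norm f)\<^sup>2 - 2 * (norm h * norm f) + (norm h)\<^sup>2 / l"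
      using l by (simp add: power2_eq_square field_simps)
    also have "\<dots> \<le> Q f + (norm h)\<^sup>2 / l"
      using form_self_nonneg[OF that] Re_cinner_le[of h f] by (simp add: Q_def N_def)
    finally show ?thesis by simp
  qed
  define d where "d = Inf (Q ` D)"
  have bdd: "bdd_below (Q ` D)"
    using Q_lower by (auto intro!: bdd_belowI)
  have d_le: "d \<le> Q f" if "f \<in> D" for f
    unfolding d_def using bdd that by (intro cInf_lower) auto
  have "\<exists>f\<in>D. Q f < d + inverse (real (Suc n))" for n
  proof -
    have "\<exists>y\<in>Q ` D. y < d + inverse (real (Suc n))"
      unfolding d_def using zero_mem by (intro cInf_lessD) auto
    then show ?thesis by blast
  qed
  then obtain u where u: "\<And>n. u n \<in> D" "\<And>n. Q (u n) < d + inverse (real (Suc n))"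
    by metis
  have Q_half: "Q ((1/2) *\<^sub>R w) = N w / 4 - Re (cinner h w)" if "w \<in> D" for w
    using that by (simp add: Q_def N_def cinner_scaleR_right form_scaleR_left form_scaleR_right
        scaleR_mem power_divide)
  \<comment> \<open>The midpoint of f and g has \<open>Q\<close> at least d; the parallelogram law
    for \<open>N\<close> turns this into a bound on their distance.\<close>
  have par: "N (f - g) \<le> 2 * Q f + 2 * Q g - 4 * d" if "f \<in> D" "g \<in> D" for f g
  proof -
    have "d \<le> Q ((1/2) *\<^sub>R (f + g))"
      using that by (intro d_le scaleR_mem add_mem)
    also have "\<dots> = N (f + g) / 4 - Re (cinner h f) - Re (cinner h g)"
      using Q_half[OF add_mem[OF that]] by (simp add: cinner_add_right)
    also have "N (f + g) = 2 * N f + 2 * N g - N (f - g)"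
      using that
      by (simp add: N_def Re_form_add Re_form_diff norm_add_sq norm_diff_sq algebra_simps)
    also have "\<dots> / 4 - Re (cinner h f) - Re (cinner h g) = Q f / 2 + Q g / 2 - N (f - g) / 4"
      by (simp add: Q_def field_simps)
    finally show ?thesis by simp
  qed
  have small: "\<exists>M. \<forall>m\<ge>M. \<forall>n\<ge>M. N (u m - u n) < e" if "e > 0" for e
  proof -
    obtain M where M: "inverse (real (Suc M)) < e / 4"
      using reals_Archimedean[of "e / 4"] \<open>e > 0\<close> by auto
    have "N (u m - u n) < e" if "m \<ge> M" "n \<ge> M" for m n
    proof -
      have "inverse (real (Suc m)) \<le> inverse (real (Suc M))"
        "inverse (real (Suc n)) \<le> inverse (real (Suc M))"
        using that by auto
      then show ?thesis
        using par[OF u(1)[of m] u(1)[of n]] u(2)[of m] u(2)[of n] M by linarith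
    qed
    then show ?thesis by blast
  qed
  have "Cauchy u"
  proof (rule metric_CauchyI)
    fix e :: real assume "e > 0"
    then obtain M where M: "\<forall>m\<ge>M. \<forall>n\<ge>M. N (u m - u n) < l * e\<^sup>2"
      using small[of "l * e\<^sup>2"] l by auto
    have "dist (u m) (u n) < e" if "m \<ge> M" "n \<ge> M" for m n
    proof -
      have "l * (norm (u m - u n))\<^sup>2 \<le> N (u m - u n)"
        using form_self_nonneg[OF diff_mem[OF u(1) u(1)]] by (simp add: N_def)
      also have "\<dots> < l * e\<^sup>2"
        using M that by blast
      finally show ?thesis
        using l \<open>e > 0\<close> by (simp add: dist_norm power_less_imp_less_base)
    qed
    then show "\<exists>M. \<forall>m\<ge>M. \<forall>n\<ge>M. dist (u m) (u n) < e" by blast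
  qed
  then obtain f where f: "u \<longlonglongrightarrow> f"
    using Cauchy_convergent_iff convergentD by blast
  have "\<exists>M. \<forall>m\<ge>M. \<forall>n\<ge>M. cmod (a (u m - u n) (u m - u n)) < e" if "e > 0" for e
  proof -
    have "cmod (a (u m - u n) (u m - u n)) \<le> N (u m - u n)" for m n
      using form_self_Im[OF diff_mem[OF u(1) u(1)]] form_self_nonneg[OF diff_mem[OF u(1) u(1)]] l
      by (simp add: N_def cmod_def)
    then show ?thesis
      using small[OF that] by (meson le_less_trans)
  qed
  then have fD: "f \<in> D" and af: "(\<lambda>n. a (u n - f) (u n - f)) \<longlonglongrightarrow> 0"
    using closed u(1) f unfolding closed_form_def by blast+
  have Q_lim: "(\<lambda>n. Q (u n)) \<longlonglongrightarrow> d"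
  proof (rule real_tendsto_sandwich)
    show "(\<lambda>n. d) \<longlonglongrightarrow> d" by simp
    show "(\<lambda>n. d + inverse (real (Suc n))) \<longlonglongrightarrow> d"
      by (rule LIMSEQ_inverse_real_of_nat_add)
  qed (use less_imp_le[OF u(2)] in \<open>auto intro!: always_eventually d_le u(1)\<close>)
  have cinner_lim: "(\<lambda>n. Re (cinner (u n) g)) \<longlonglongrightarrow> Re (cinner f g)" for g
  proof -
    have "(\<lambda>n. norm (u n - f) * norm g) \<longlonglongrightarrow> 0"
      using tendsto_norm_zero[OF LIM_zero[OF f]] by (rule tendsto_mult_left_zero)
    then have "(\<lambda>n. Re (cinner (u n) g) - Re (cinner f g)) \<longlonglongrightarrow> 0"
    proof (rule Lim_null_comparison[rotated])
      show "\<forall>\<^sub>F n in sequentially. norm (Re (cinner (u n) g) - Re (cinner f g))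
          \<le> norm (u n - f) * norm g"
        using abs_Re_cinner_le[of "u _ - f" g]
        by (intro always_eventually allI) (simp add: cinner_diff_left)
    qed
    then show ?thesis by (simp add: LIM_zero_iff)
  qed
  \<comment> \<open>The limit is taken in d \<le> Q (u n + g), expanded by \<open>Q_add\<close>. As
    Q (u n) tends to d, the value of \<open>Q\<close> at f itself does not enter.\<close>
  have pos: "0 \<le> 2 * L f g + N g" if g: "g \<in> D" for g
  proof -
    have "(\<lambda>n. L (u n) g) \<longlonglongrightarrow> L f g"
      unfolding L_def by (intro tendsto_intros form_tendsto_left cinner_lim u fD g af)
    then have "(\<lambda>n. Q (u n) + 2 * L (u n) g + N g) \<longlonglongrightarrow> d + 2 * L f g + N g"
      by (intro tendsto_intros Q_lim)
    moreover have "d \<le> Q (u n) + 2 * L (u n) g + N g" for n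
      using d_le[OF add_mem[OF u(1)[of n] g]] Q_add[OF u(1) g] by simp
    ultimately have "d \<le> d + 2 * L f g + N g"
      by (intro LIMSEQ_le_const) auto
    then show ?thesis by simp
  qed
  have L0: "L f g = 0" if g: "g \<in> D" for g
  proof (rule quadratic_nonneg_imp_linear_zero)
    fix t :: real
    have "L f (t *\<^sub>R g) = t * L f g" "N (t *\<^sub>R g) = t\<^sup>2 * N g"
      using g fD by (simp_all add: L_def N_def form_scaleR_right form_scaleR_left cinner_scaleR_right
          scaleR_mem power_mult_distrib algebra_simps power2_eq_square)
    then show "0 \<le> 2 * t * L f g + t\<^sup>2 * N g"
      using pos[OF scaleR_mem[OF g, of t]] by simp
  qed
  show thesis
  proof (rule that[OF fD])
    fix g assume g: "g \<in> D"
    show "a f g + of_real l * cinner f g = cinner h g"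
    proof (rule complex_eqI)
      show "Re (a f g + of_real l * cinner f g) = Re (cinner h g)"
        using L0[OF g] by (simp add: L_def)
      show "Im (a f g + of_real l * cinner f g) = Im (cinner h g)"
        \<comment> \<open>Testing with ig turns real parts into imaginary parts.\<close>
        using L0[OF scaleC_mem[OF g, of \<i>]] g fD
        by (simp add: L_def form_scaleC_right cinner_scaleC_right)
    qed
  qed
qed

end

section \<open>The resolvent as a positive self-adjoint contraction\<close>

context nonneg_closed_form
begin

lemma assoc_op_eqI:
  assumes k: "\<forall>g\<in>D. a v g = cinner k g"
  shows "assoc_op D a v = k"
  unfolding assoc_op_def
proof (rule the_equality[where P = "\<lambda>h. \<forall>g\<in>D. a v g = cinner h g", OF k])
  fix h assume "\<forall>g\<in>D. a v g = cinner h g"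
  with k show "h = k"
    by (intro cinner_ext[OF dense]) metis
qed

text \<open>Reduces the resolvent to the weak equation, so that later arguments avoid
  \<open>inv_into\<close> and \<open>THE\<close>.\<close>

lemma resolvent_eqI:
  assumes f: "f \<in> D" and eq: "\<And>g. g \<in> D \<Longrightarrow> a f g + cinner f g = cinner h g"
  shows "resolvent D a h = f"
proof -
  have af: "\<forall>g\<in>D. a f g = cinner (h - f) g"
    using eq by (auto simp: cinner_diff_left eq_diff_eq)
  then have fdom: "f \<in> assoc_dom D a" and fh: "assoc_op D a f + f = h"
    using f assoc_op_eqI[OF af] by (auto simp: assoc_dom_def)
  have "inj_on (\<lambda>v. assoc_op D a v + v) (assoc_dom D a)"
  proof (rule inj_onI)
    fix v w assume v: "v \<in> assoc_dom D a" and w: "w \<in> assoc_dom D a"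
      and vw: "assoc_op D a v + v = assoc_op D a w + w"
    from v w obtain k l where k: "v \<in> D" "\<forall>g\<in>D. a v g = cinner k g"
      and l: "w \<in> D" "\<forall>g\<in>D. a w g = cinner l g"
      by (auto simp: assoc_dom_def)
    have d: "v - w \<in> D"
      using k l by (intro diff_mem)
    have "k + v = l + w"
      using assoc_op_eqI[OF k(2)] assoc_op_eqI[OF l(2)] vw by simp
    then have "k - l = - (v - w)"
      by (simp add: algebra_simps)
    moreover have "a (v - w) (v - w) = cinner (k - l) (v - w)"
      using d k l by (simp add: form_diff_left cinner_diff_left)
    \<comment> \<open>A non-negative number equals minus a squared norm, so both vanish.\<close>
    ultimately have "a (v - w) (v - w) = - cinner (v - w) (v - w)"
      by (simp only: cinner_minus_left)
    then show "v = w"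
      using form_self_nonneg[OF d] by (simp add: cinner_self)
  qed
  then have "inv_into (assoc_dom D a) (\<lambda>v. assoc_op D a v + v) (assoc_op D a f + f) = f"
    using fdom by (rule inv_into_f_f)
  then show ?thesis
    by (simp add: resolvent_def fh)
qed

lemma resolvent_mem: "resolvent D a h \<in> D"
  and resolvent_weak:
    "g \<in> D \<Longrightarrow> a (resolvent D a h) g + cinner (resolvent D a h) g = cinner h g"
proof -
  obtain f where f: "f \<in> D" "\<And>g. g \<in> D \<Longrightarrow> a f g + of_real 1 * cinner f g = cinner h g"
    by (rule weak_solution_exists[of 1 h]) auto
  then have "resolvent D a h = f"
    by (intro resolvent_eqI) auto
  with f show "resolvent D a h \<in> D"
    "g \<in> D \<Longrightarrow> a (resolvent D a h) g + cinner (resolvent D a h) g = cinner h g"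
    by auto
qed

text \<open>Testing the weak equation for x with R y, and that for y with R x, gives the same
  Hermitian expression.\<close>

lemma resolvent_selfadjoint: "cinner (resolvent D a x) y = cinner x (resolvent D a y)"
proof -
  let ?R = "resolvent D a"
  have "cinner x (?R y) = a (?R x) (?R y) + cinner (?R x) (?R y)"
    by (simp add: resolvent_weak resolvent_mem)
  also have "\<dots> = cnj (a (?R y) (?R x) + cinner (?R y) (?R x))"
    using form_hermitian[of "?R x" "?R y"] cinner_commute[of "?R x" "?R y"]
    by (simp add: resolvent_mem)
  also have "\<dots> = cnj (cinner y (?R x))"
    by (simp add: resolvent_weak resolvent_mem)
  finally show ?thesis
    by (metis cinner_commute)
qed

text \<open>The weak equation tested with its own solution. It yields both the contraction bound and
  the energy of approximate eigenvectors.\<close>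

lemma Re_form_resolvent:
  "Re (a (resolvent D a h) (resolvent D a h))
     = Re (cinner h (resolvent D a h)) - (norm (resolvent D a h))\<^sup>2"
  using arg_cong[OF resolvent_weak[of "resolvent D a h" h], of Re]
  by (simp add: resolvent_mem cinner_self)

lemma norm_resolvent_le: "norm (resolvent D a h) \<le> norm h"
proof -
  have "(norm (resolvent D a h))\<^sup>2 \<le> Re (cinner h (resolvent D a h))"
    using Re_form_resolvent[of h] form_self_nonneg[OF resolvent_mem[of h]] by simp
  also have "\<dots> \<le> norm h * norm (resolvent D a h)"
    by (rule Re_cinner_le)
  finally show ?thesis
    by (cases "resolvent D a h = 0") (auto simp: power2_eq_square)
qed

lemma resolvent_bounded_clinear: "bounded_clinear (resolvent D a)"
proof -
  let ?R = "resolvent D a"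
  have add: "?R (x + y) = ?R x + ?R y" for x y
    using resolvent_weak[of _ x] resolvent_weak[of _ y]
    by (intro resolvent_eqI)
      (auto simp: add_mem resolvent_mem form_add_left cinner_add_left algebra_simps)
  have scaleC: "?R (c *\<^sub>C x) = c *\<^sub>C ?R x" for c x
    using resolvent_weak[of _ x]
    by (intro resolvent_eqI)
      (auto simp: scaleC_mem resolvent_mem form_scaleC_left cinner_scaleC_left
        simp flip: distrib_left)
  have "bounded_linear ?R"
  proof (rule bounded_linear_intro)
    show "?R (r *\<^sub>R x) = r *\<^sub>R ?R x" for r x
      using scaleC[of "of_real r" x] by (simp add: scaleC_of_real)
    show "norm (?R x) \<le> norm x * 1" for x
      using norm_resolvent_le[of x] by simp
  qed (rule add)
  with scaleC show ?thesis
    by (auto simp: bounded_clinear_def)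
qed

lemma resolvent_assoc_op:
  assumes "f \<in> assoc_dom D a"
  shows "resolvent D a (assoc_op D a f + f) = f"
proof -
  obtain k where k: "f \<in> D" "\<forall>g\<in>D. a f g = cinner k g"
    using assms by (auto simp: assoc_dom_def)
  then have "assoc_op D a f = k"
    by (intro assoc_op_eqI)
  with k show ?thesis
    by (intro resolvent_eqI) (auto simp: cinner_add_left)
qed

text \<open>A bounded inverse of the resolvent agrees with A + I on the domain of A, which would
  make A bounded.\<close>

lemma zero_in_spectrum_resolvent:
  assumes "unbounded_on (assoc_dom D a) (assoc_op D a)"
  shows "0 \<in> spectrum (resolvent D a)"
proof (rule ccontr)
  assume "0 \<notin> spectrum (resolvent D a)"
  then obtain S where S: "bounded_clinear S" "\<And>x. S (resolvent D a x) = x"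
    by (auto simp: spectrum_def)
  have "bounded_linear S"
    using S(1) by (simp add: bounded_clinear_def)
  then obtain K where K: "\<And>x. norm (S x) \<le> norm x * K"
    using bounded_linear.pos_bounded by blast
  have "norm (assoc_op D a f) \<le> (K + 1) * norm f" if "f \<in> assoc_dom D a" for f
  proof -
    have "S f = assoc_op D a f + f"
      using S(2)[of "assoc_op D a f + f"] resolvent_assoc_op[OF that] by simp
    then have "assoc_op D a f = S f - f"
      by simp
    then have "norm (assoc_op D a f) \<le> norm (S f) + norm f"
      by (simp only: norm_triangle_ineq4)
    also have "\<dots> \<le> (K + 1) * norm f"
      using K[of f] by (simp add: algebra_simps)
    finally show ?thesis .
  qed
  then show False
    using assms by (auto simp: unbounded_on_def)
qed

end

section \<open>Spectra of self-adjoint operators\<close>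

definition selfadjoint :: "('a::chilbert_space \<Rightarrow> 'a) \<Rightarrow> bool" where
  "selfadjoint T \<longleftrightarrow> bounded_clinear T \<and> (\<forall>x y. cinner (T x) y = cinner x (T y))"

lemma bounded_clinear_shift:
  assumes "bounded_clinear T"
  shows "bounded_clinear (\<lambda>x. T x - z *\<^sub>C x)"
proof -
  have lin: "bounded_linear (\<lambda>x::'a. z *\<^sub>C x)"
  proof (rule bounded_linear_intro)
    show "z *\<^sub>C (r *\<^sub>R x) = r *\<^sub>R (z *\<^sub>C x)" for r and x :: 'a
      by (simp add: scaleC_scaleC mult.commute flip: scaleC_of_real)
    show "norm (z *\<^sub>C x) \<le> norm x * cmod z" for x :: 'a
      by simp
  qed (rule scaleC_add_right)
  show ?thesis
    using assms unfolding bounded_clinear_def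
    by (auto intro!: bounded_linear_sub lin simp: scaleC_diff_right scaleC_scaleC mult.commute)
qed

lemma bounded_clinear_add: "bounded_clinear T \<Longrightarrow> T (x + y) = T x + T y"
  and bounded_clinear_diff: "bounded_clinear T \<Longrightarrow> T (x - y) = T x - T y"
  and bounded_clinear_scaleC: "bounded_clinear T \<Longrightarrow> T (c *\<^sub>C x) = c *\<^sub>C T x"
  and bounded_clinear_scaleR: "bounded_clinear T \<Longrightarrow> T (r *\<^sub>R x) = r *\<^sub>R T x"
  by (auto simp: bounded_clinear_def linear_simps bounded_linear.linear linear_diff linear_add linear_scale)

lemma selfadjoint_Im:
  assumes "selfadjoint T"
  shows "Im (cinner (T x) x) = 0"
  using assms cinner_commute[of x "T x"] unfolding selfadjoint_def
  by (metis complex_cnj_cancel_iff cnj.simps(2) neg_equal_0_iff_equal equal_neg_zero)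

text \<open>Since (T x, x) is real, expanding the squares gives the same cross term. A lower bound
  for T - z thus carries over to its adjoint.\<close>

lemma selfadjoint_norm_shift_cnj:
  assumes "selfadjoint T"
  shows "norm (T x - cnj z *\<^sub>C x) = norm (T x - z *\<^sub>C x)"
proof -
  have "(norm (T x - cnj z *\<^sub>C x))\<^sup>2 = (norm (T x - z *\<^sub>C x))\<^sup>2"
    by (simp add: norm_diff_sq cinner_scaleC_right selfadjoint_Im[OF assms])
  then show ?thesis
    by (simp add: power2_eq_iff_nonneg)
qed

text \<open>With \<open>S = T - z\<^sup>*\<close>, a solution of \<open>(S f, S g) = (h, g)\<close> provides the preimage \<open>S f\<close> of
  \<open>h\<close> under \<open>T - z\<close>.\<close>

lemma selfadjoint_shift_surj:
  assumes T: "selfadjoint T" and c: "0 < c"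
    and low: "\<And>x. c * norm x \<le> norm (T x - z *\<^sub>C x)"
  obtains y where "T y - z *\<^sub>C y = h"
proof -
  define S where "S x = T x - cnj z *\<^sub>C x" for x
  have S: "bounded_clinear S"
    using T unfolding S_def selfadjoint_def by (auto intro: bounded_clinear_shift)
  have Slow: "c\<^sup>2 * (norm x)\<^sup>2 \<le> (norm (S x))\<^sup>2" for x
  proof -
    have "(c * norm x)\<^sup>2 \<le> (norm (S x))\<^sup>2"
      using low[of x] selfadjoint_norm_shift_cnj[OF T] c
      by (intro power_mono) (auto simp: S_def)
    then show ?thesis by (simp add: power_mult_distrib)
  qed
  \<comment> \<open>Subtracting c^2 (f, g) keeps the form non-negative by \<open>Slow\<close>, and
    the weak equation with l = c^2 adds it back.\<close>
  define b where "b f g = cinner (S f) (S g) - of_real (c\<^sup>2) * cinner f g" for f g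
  have bself: "b f f = of_real ((norm (S f))\<^sup>2 - c\<^sup>2 * (norm f)\<^sup>2)" for f
    by (simp add: b_def cinner_self)
  have closed_b: "(\<lambda>n. b (u n - f) (u n - f)) \<longlonglongrightarrow> 0" if u: "u \<longlonglongrightarrow> f" for u :: "nat \<Rightarrow> 'a" and f
  proof -
    have "(\<lambda>n. u n - f) \<longlonglongrightarrow> 0"
      using u by (rule LIM_zero)
    moreover have "bounded_linear S"
      using S by (simp add: bounded_clinear_def)
    note bounded_linear.tendsto[OF this calculation]
    ultimately have "(\<lambda>n. b (u n - f) (u n - f)) \<longlonglongrightarrow> of_real ((norm (S 0))\<^sup>2 - c\<^sup>2 * (norm (0::'a))\<^sup>2)"
      unfolding bself by (intro tendsto_intros)
    moreover have "S 0 = 0"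
      using bounded_clinear_diff[OF S, of 0 0] by simp
    ultimately show ?thesis by simp
  qed
  interpret nonneg_closed_form UNIV b
  proof
    show "sesquilinear_form UNIV b"
      unfolding sesquilinear_form_def csubspace_def b_def
      by (simp add: bounded_clinear_add[OF S] bounded_clinear_scaleC[OF S] cinner_add_left
          cinner_add_right cinner_scaleC_left cinner_scaleC_right algebra_simps)
    show "densely_defined UNIV" by (rule densely_defined_UNIV)
    show "nonneg_form UNIV b"
      unfolding nonneg_form_def bself using Slow by (simp del: of_real_diff)
    show "closed_form UNIV b"
      unfolding closed_form_def using closed_b by blast
  qed
  obtain f where f: "\<And>g. b f g + of_real (c\<^sup>2) * cinner f g = cinner h g"
    by (rule weak_solution_exists[of "c\<^sup>2" h]) (use c in auto)
  have "T (S f) - z *\<^sub>C S f = h"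
  proof (rule cinner_ext[OF densely_defined_UNIV])
    fix g
    have "cinner (T (S f) - z *\<^sub>C S f) g = cinner (S f) (S g)"
      using T unfolding selfadjoint_def S_def[of g]
      by (simp add: cinner_diff_left cinner_diff_right cinner_scaleC_left cinner_scaleC_right)
    then show "cinner (T (S f) - z *\<^sub>C S f) g = cinner h g"
      using f[of g] by (simp add: b_def)
  qed
  then show thesis by (rule that)
qed

text \<open>A bounded inverse gives the lower bound. Conversely, the lower bound gives injectivity
  and, by self-adjointness, surjectivity; it also bounds the inverse.\<close>

lemma selfadjoint_notin_spectrum_iff:
  assumes T: "selfadjoint T"
  shows "z \<notin> spectrum T \<longleftrightarrow> (\<exists>c>0. \<forall>x. c * norm x \<le> norm (T x - z *\<^sub>C x))"
proof
  assume "z \<notin> spectrum T"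
  then obtain S where S: "bounded_clinear S" "\<And>x. S (T x - z *\<^sub>C x) = x"
    by (auto simp: spectrum_def)
  have "bounded_linear S"
    using S(1) by (simp add: bounded_clinear_def)
  then obtain K where K: "K > 0" "\<And>x. norm (S x) \<le> norm x * K"
    using bounded_linear.pos_bounded by blast
  have "1 / K * norm x \<le> norm (T x - z *\<^sub>C x)" for x
    using K(2)[of "T x - z *\<^sub>C x"] S(2)[of x] K(1) by (simp add: field_simps)
  then show "\<exists>c>0. \<forall>x. c * norm x \<le> norm (T x - z *\<^sub>C x)"
    using K(1) by (intro exI[of _ "1 / K"]) auto
next
  assume "\<exists>c>0. \<forall>x. c * norm x \<le> norm (T x - z *\<^sub>C x)"
  then obtain c where c: "0 < c" "\<And>x. c * norm x \<le> norm (T x - z *\<^sub>C x)"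
    by blast
  define S where "S x = T x - z *\<^sub>C x" for x
  have S: "bounded_clinear S"
    using T unfolding S_def selfadjoint_def by (auto intro: bounded_clinear_shift)
  have inj: "x = y" if "S x = S y" for x y
  proof -
    have "S (x - y) = 0"
      using that by (simp add: bounded_clinear_diff[OF S])
    then have "c * norm (x - y) \<le> 0"
      using c(2)[of "x - y"] unfolding S_def by simp
    then show ?thesis
      using c(1) by (simp add: mult_le_0_iff)
  qed
  have "\<forall>h. \<exists>y. S y = h"
    using selfadjoint_shift_surj[OF T c] unfolding S_def by blast
  then obtain V where V: "\<And>h. S (V h) = h"
    by metis
  have add: "V (x + y) = V x + V y" for x y
    by (rule inj) (simp add: V bounded_clinear_add[OF S])
  have scaleC: "V (k *\<^sub>C x) = k *\<^sub>C V x" for k x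
    by (rule inj) (simp add: V bounded_clinear_scaleC[OF S])
  have "bounded_linear V"
  proof (rule bounded_linear_intro)
    show "V (r *\<^sub>R x) = r *\<^sub>R V x" for r x
      using scaleC[of "of_real r" x] by (simp add: scaleC_of_real)
    show "norm (V x) \<le> norm x * (1 / c)" for x
      using c(2)[of "V x"] V[of x] c(1) unfolding S_def by (simp add: field_simps)
  qed (rule add)
  then have "bounded_clinear V"
    using scaleC by (auto simp: bounded_clinear_def)
  moreover have "V (S x) = x" for x
    by (rule inj) (rule V)
  ultimately show "z \<notin> spectrum T"
    using V unfolding spectrum_def S_def by blast
qed

text \<open>The imaginary part of ((T - z) x, x) is -Im z times the squared norm of x, so T - z is
  bounded below by the modulus of Im z.\<close>

lemma selfadjoint_spectrum_real:
  assumes T: "selfadjoint T" and z: "z \<in> spectrum T"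
  obtains r where "z = complex_of_real r"
proof -
  have "\<bar>Im z\<bar> * norm x \<le> norm (T x - z *\<^sub>C x)" for x
  proof (cases "x = 0")
    case False
    have "Im (cinner (T x - z *\<^sub>C x) x) = - Im z * (norm x)\<^sup>2"
      using selfadjoint_Im[OF T] by (simp add: cinner_diff_left cinner_scaleC_left cinner_self)
    then have "\<bar>Im z\<bar> * (norm x)\<^sup>2 \<le> norm (T x - z *\<^sub>C x) * norm x"
      using abs_Im_cinner_le[of "T x - z *\<^sub>C x" x] by (simp add: abs_mult)
    then show ?thesis
      using False by (simp add: power2_eq_square)
  qed simp
  then have "Im z = 0"
    using z selfadjoint_notin_spectrum_iff[OF T, of z] by (metis zero_less_abs_iff)
  then show thesis
    using that[of "Re z"] by (simp add: complex_eq_iff)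
qed

text \<open>No constant 1 / (n + 1) is a lower bound for T - z; a violating vector is normalised for
  each n.\<close>

lemma selfadjoint_approx_eigenvectors:
  assumes T: "selfadjoint T" and z: "z \<in> spectrum T"
  obtains f :: "nat \<Rightarrow> 'a::chilbert_space"
  where "\<And>n. norm (f n) = 1" "(\<lambda>n. norm (T (f n) - z *\<^sub>C f n)) \<longlonglongrightarrow> 0"
proof -
  have lin: "bounded_clinear (\<lambda>x. T x - z *\<^sub>C x)"
    using T unfolding selfadjoint_def by (auto intro: bounded_clinear_shift)
  have "\<exists>f. norm f = 1 \<and> norm (T f - z *\<^sub>C f) < inverse (real (Suc n))" for n
  proof -
    have "\<not> (\<forall>x. inverse (real (Suc n)) * norm x \<le> norm (T x - z *\<^sub>C x))"
      using z selfadjoint_notin_spectrum_iff[OF T, of z]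
      by (metis of_nat_0_less_iff positive_imp_inverse_positive zero_less_Suc)
    then obtain x where x: "norm (T x - z *\<^sub>C x) < inverse (real (Suc n)) * norm x"
      by (auto simp: not_le)
    then have "x \<noteq> 0" by auto
    have "norm (T (x /\<^sub>R norm x) - z *\<^sub>C (x /\<^sub>R norm x)) = norm (T x - z *\<^sub>C x) / norm x"
      unfolding bounded_clinear_scaleR[OF lin] by (simp add: divide_inverse_commute)
    also have "\<dots> < inverse (real (Suc n))"
      using x \<open>x \<noteq> 0\<close> by (simp add: pos_divide_less_eq)
    finally show ?thesis
      using \<open>x \<noteq> 0\<close> by (intro exI[of _ "x /\<^sub>R norm x"]) simp
  qed
  then obtain f where f: "\<And>n. norm (f n) = 1"
      "\<And>n. norm (T (f n) - z *\<^sub>C f n) < inverse (real (Suc n))"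
    by metis
  have "(\<lambda>n. norm (T (f n) - z *\<^sub>C f n)) \<longlonglongrightarrow> 0"
    by (rule real_tendsto_sandwich[OF _ _ tendsto_const LIMSEQ_inverse_real_of_nat])
      (use less_imp_le[OF f(2)] in \<open>auto intro!: always_eventually\<close>)
  with f(1) show thesis by (rule that)
qed

text \<open>Writing \<open>S = T - r\<close> and \<open>m\<close> for the infimum of \<open>\<parallel>S u\<parallel>\<close> over unit vectors, the operator
  \<open>P = S\<^sup>2 - m\<^sup>2 = (S - m) (S + m)\<close> is non-negative and satisfies \<open>\<parallel>P u\<parallel>\<^sup>2 \<le> K (P u, u)\<close>. Hence \<open>P\<close>
  is not bounded below, and one of \<open>r \<plusminus> m\<close> lies in the spectrum.\<close>

lemma selfadjoint_nearest_spectrum: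
  fixes T :: "'a::chilbert_space \<Rightarrow> 'a"
  assumes T: "selfadjoint T" and x: "(x::'a) \<noteq> 0"
  obtains w where "w \<in> spectrum T"
    "\<And>u. dist (complex_of_real r) w * norm u \<le> norm (T u - complex_of_real r *\<^sub>C u)"
proof -
  have Tlin: "bounded_clinear T"
    using T by (simp add: selfadjoint_def)
  define S where "S u = T u - complex_of_real r *\<^sub>C u" for u
  have S: "bounded_clinear S"
    unfolding S_def by (rule bounded_clinear_shift[OF Tlin])
  have Ssa: "cinner (S u) v = cinner u (S v)" for u v
    using T by (simp add: S_def selfadjoint_def cinner_diff_left cinner_diff_right
        cinner_scaleC_left cinner_scaleC_right)
  define U where "U = (\<lambda>u. norm (S u)) ` {u. norm u = 1}"
  define m where "m = Inf U"
  have bdd: "bdd_below U"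
    by (auto simp: U_def intro!: bdd_belowI[of _ 0])
  have "norm (x /\<^sub>R norm x) = 1"
    using x by simp
  then have ne: "U \<noteq> {}"
    unfolding U_def by blast
  have m0: "0 \<le> m"
    unfolding m_def using ne by (intro cInf_greatest) (auto simp: U_def)
  have m_le: "m * norm u \<le> norm (S u)" for u
  proof (cases "u = 0")
    case False
    then have "m \<le> norm (S (u /\<^sub>R norm u))"
      unfolding m_def U_def by (intro cInf_lower bdd[unfolded U_def]) auto
    then show ?thesis
      using False by (simp add: bounded_clinear_scaleR[OF S] field_simps)
  qed simp
  define P where "P u = S (S u) - (m\<^sup>2) *\<^sub>R u" for u
  have P_bl: "bounded_linear P"
    unfolding P_def using S unfolding bounded_clinear_def
    by (intro bounded_linear_sub bounded_linear_compose[of S S] bounded_linear_scaleR_right) auto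
  then obtain K where K: "0 < K" "\<And>u. norm (P u) \<le> norm u * K"
    using bounded_linear.pos_bounded by blast
  have Pform: "Re (cinner (P u) u) = (norm (S u))\<^sup>2 - m\<^sup>2 * (norm u)\<^sup>2" for u
    by (simp add: P_def cinner_diff_left Ssa cinner_scaleR_left cinner_self)
  have Psa: "cinner (P u) v = cinner u (P v)" for u v
    by (simp add: P_def cinner_diff_left cinner_diff_right Ssa cinner_scaleR_left cinner_scaleR_right)
  have Ppos: "0 \<le> Re (cinner (P u) u)" for u
    using power_mono[OF m_le[of u], of 2] m0 by (simp add: Pform power_mult_distrib)
  have P_sq: "(norm (P u))\<^sup>2 \<le> K * Re (cinner (P u) u)" for u
  proof -
    \<comment> \<open>Positivity of (P v, v) at this v gives the estimate, since K bounds the norm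
      of \<open>P\<close>.\<close>
    define v where "v = u - (1 / K) *\<^sub>R P u"
    have "Re (cinner (P v) v) = Re (cinner (P u) u) - 2 / K * (norm (P u))\<^sup>2
        + (1 / K)\<^sup>2 * Re (cinner (P (P u)) (P u))"
      using P_bl Psa[of "P u" u]
      by (simp add: v_def linear_simps cinner_diff_left cinner_diff_right cinner_scaleR_left
          cinner_scaleR_right cinner_self power2_eq_square algebra_simps diff_divide_distrib)
    also have "\<dots> \<le> Re (cinner (P u) u) - 2 / K * (norm (P u))\<^sup>2
        + (1 / K)\<^sup>2 * (K * (norm (P u))\<^sup>2)"
    proof (intro add_left_mono mult_left_mono)
      have "Re (cinner (P (P u)) (P u)) \<le> norm (P (P u)) * norm (P u)"
        by (rule Re_cinner_le)
      also have "\<dots> \<le> (norm (P u) * K) * norm (P u)"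
        by (intro mult_right_mono K) simp
      finally show "Re (cinner (P (P u)) (P u)) \<le> K * (norm (P u))\<^sup>2"
        by (simp add: power2_eq_square mult_ac)
    qed simp
    also have "\<dots> = Re (cinner (P u) u) - (norm (P u))\<^sup>2 / K"
      using K(1) by (simp add: power2_eq_square field_simps)
    finally show ?thesis
      using mult_nonneg_nonneg[OF less_imp_le[OF K(1)] Ppos[of v]] K(1) by (simp add: field_simps)
  qed
  have "complex_of_real (r + m) \<in> spectrum T \<or> complex_of_real (r - m) \<in> spectrum T"
  proof (rule ccontr)
    assume "\<not> ?thesis"
    then have "complex_of_real (r + m) \<notin> spectrum T" "complex_of_real (r - m) \<notin> spectrum T"
      by auto
    then obtain c1 c2 where c1: "0 < c1" "\<And>u. c1 * norm u \<le> norm (T u - complex_of_real (r + m) *\<^sub>C u)"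
      and c2: "0 < c2" "\<And>u. c2 * norm u \<le> norm (T u - complex_of_real (r - m) *\<^sub>C u)"
      unfolding selfadjoint_notin_spectrum_iff[OF T] by blast
    \<comment> \<open>If both r + m and r - m were outside the spectrum, factoring \<open>P\<close>
      would give norm (P u) \<ge> c1 c2 on unit vectors. By \<open>P_sq\<close> the square of norm
      (S u) then exceeds m^2 by at least d, against the choice of m as infimum.\<close>
    define d where "d = (c1 * c2)\<^sup>2 / K"
    have d: "0 < d"
      using c1 c2 K by (simp add: d_def)
    have "sqrt (m\<^sup>2 + d) \<le> norm (S u)" if u: "norm u = 1" for u
    proof -
      define y where "y = S u + m *\<^sub>R u"
      have y: "y = T u - complex_of_real (r - m) *\<^sub>C u"
        by (simp only: y_def S_def scaleC_of_real) (simp add: algebra_simps)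
      have "P u = T y - complex_of_real (r + m) *\<^sub>C y"
      proof -
        have "T y - complex_of_real (r + m) *\<^sub>C y = S y - m *\<^sub>R y"
          by (simp only: S_def scaleC_of_real) (simp add: algebra_simps)
        also have "\<dots> = P u"
          by (simp add: y_def P_def bounded_clinear_add[OF S] bounded_clinear_scaleR[OF S]
              algebra_simps power2_eq_square)
        finally show ?thesis by simp
      qed
      then have "c1 * norm y \<le> norm (P u)"
        using c1(2) by simp
      moreover have "c2 \<le> norm y"
        using c2(2)[of u] u y by simp
      ultimately have "c1 * c2 \<le> norm (P u)"
        using c1(1) by (meson mult_left_mono less_imp_le order_trans)
      then have "(c1 * c2)\<^sup>2 \<le> (norm (P u))\<^sup>2"
        using c1(1) c2(1) by (intro power_mono) auto
      also have "\<dots> \<le> K * ((norm (S u))\<^sup>2 - m\<^sup>2)"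
        using P_sq[of u] u by (simp add: Pform)
      finally have "m\<^sup>2 + d \<le> (norm (S u))\<^sup>2"
        using K(1) by (simp add: d_def field_simps)
      then show ?thesis
        by (intro real_le_lsqrt) auto
    qed
    then have "sqrt (m\<^sup>2 + d) \<le> m"
      unfolding m_def using ne by (intro cInf_greatest) (auto simp: U_def)
    then show False
      using d m0 by (simp add: real_sqrt_le_iff')
  qed
  then obtain w where w: "w \<in> spectrum T" "dist (complex_of_real r) w = m"
    using m0 by (auto simp: dist_norm)
  show thesis
    using that[OF w(1)] m_le unfolding w(2) S_def by simp
qed

section \<open>Comparison of spectra\<close>

text \<open>For \<open>r > \<nu> / (1 - \<kappa>)\<close> and \<open>g = R (f n)\<close>, with \<open>f n\<close> approximate eigenvectors, \<open>a[g, g]\<close> is close to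
  \<open>(1 / r - 1) \<parallel>g\<parallel>\<^sup>2\<close>, so that the term \<open>\<nu> a[g, g]\<close> is at most \<open>(1 - \<kappa>) \<parallel>g\<parallel>\<^sup>2\<close> up to a small error.\<close>

lemma (in nonneg_closed_form) spectrum_resolvent_near:
  fixes T :: "'k::chilbert_space \<Rightarrow> 'k" and J :: "'a \<Rightarrow> 'k"
  assumes T: "selfadjoint T" and zero: "0 \<in> spectrum T"
    and J: "bounded_clinear J"
    and comm: "onorm (\<lambda>f. T (J f) - J (resolvent D a f)) \<le> \<eta>"
    and J_low: "\<And>f. f \<in> D \<Longrightarrow> (norm f)\<^sup>2 \<le> \<mu> * (norm (J f))\<^sup>2 + \<nu> * Re (a f f)"
    and pos: "0 \<le> \<eta>" "0 \<le> \<mu>" "0 \<le> \<nu>" "0 < \<kappa>" "\<kappa> < 1"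
    and z: "z \<in> spectrum (resolvent D a)"
  obtains w where "w \<in> spectrum T" "dist z w \<le> max (\<eta> * sqrt (\<mu> / \<kappa>)) (\<nu> / (1 - \<kappa>))"
proof -
  let ?R = "resolvent D a"
  have R_sa: "selfadjoint ?R"
    by (simp add: selfadjoint_def resolvent_bounded_clinear resolvent_selfadjoint)
  have R_bl: "bounded_linear ?R" and J_bl: "bounded_linear J" and T_bl: "bounded_linear T"
    using resolvent_bounded_clinear J T by (auto simp: bounded_clinear_def selfadjoint_def)
  obtain r where r: "z = complex_of_real r"
    using selfadjoint_spectrum_real[OF R_sa z] by blast
  obtain f where f: "\<And>n::nat. norm (f n) = 1"
    and "(\<lambda>n. norm (?R (f n) - z *\<^sub>C f n)) \<longlonglongrightarrow> 0"
    using selfadjoint_approx_eigenvectors[OF R_sa z] by blast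
  moreover define e where "e n = ?R (f n) - r *\<^sub>R f n" for n
  ultimately have e: "(\<lambda>n. norm (e n)) \<longlonglongrightarrow> 0"
    by (simp add: r scaleC_of_real)
  \<comment> \<open>The \<open>f n\<close> need not lie in the form domain, but their images under
    the resolvent do, and these are approximate eigenvectors too.\<close>
  define g where "g n = ?R (f n)" for n
  have gD: "g n \<in> D" for n
    by (simp add: g_def resolvent_mem)
  have Re_fg: "(norm (g n))\<^sup>2 \<le> Re (cinner (f n) (g n))" for n
    using Re_form_resolvent[of "f n"] form_self_nonneg[OF gD[of n]] by (simp add: g_def)
  have "0 \<le> r"
  proof -
    have "- norm (e n) \<le> r" for n
    proof -
      have "0 \<le> Re (cinner (g n) (f n))"
        using Re_fg[of n] by (simp add: Re_cinner_commute order_trans[OF zero_le_power2])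
      also have "\<dots> = Re (cinner (e n) (f n)) + r"
        by (simp add: e_def g_def cinner_diff_left cinner_scaleR_left cinner_self f)
      also have "\<dots> \<le> norm (e n) + r"
        using Re_cinner_le[of "e n" "f n"] by (simp add: f)
      finally show ?thesis by simp
    qed
    then have "- 0 \<le> r"
      by (intro LIMSEQ_le_const2[OF tendsto_minus[OF e]]) auto
    then show ?thesis by simp
  qed
  show thesis
  proof (cases "r \<le> \<nu> / (1 - \<kappa>)")
    case True
    then show ?thesis
      using zero \<open>0 \<le> r\<close> by (intro that[of 0]) (auto simp: r dist_norm)
  next
    case False
    have \<nu>: "\<nu> < r * (1 - \<kappa>)"
      using False pos by (simp add: field_simps)
    have "0 < r"
      using False pos by (meson diff_ge_0_iff_ge divide_nonneg_nonneg le_less_trans less_imp_le not_le)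
    \<comment> \<open>The nearest-point lemma needs a nonzero vector in the target space; 0 in the
      spectrum of T supplies one, as T is not bounded below by 1.\<close>
    have "\<not> (\<forall>x. 1 * norm x \<le> norm (T x - 0 *\<^sub>C x))"
      using zero selfadjoint_notin_spectrum_iff[OF T] zero_less_one by blast
    then obtain x :: 'k where "norm (T x) < norm x"
      by (auto simp: not_le)
    then have "x \<noteq> 0"
      using norm_ge_zero[of "T x"] by auto
    then obtain w where w: "w \<in> spectrum T"
      and w_low: "\<And>u. dist z w * norm u \<le> norm (T u - complex_of_real r *\<^sub>C u)"
      using selfadjoint_nearest_spectrum[OF T, of x r] r by metis
    define m where "m = dist z w"
    obtain K where K: "0 < K" "\<And>x. norm (J x) \<le> norm x * K"
      using bounded_linear.pos_bounded[OF J_bl] by blast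
    have comm_bl: "bounded_linear (\<lambda>f. T (J f) - J (?R f))"
      by (intro bounded_linear_sub bounded_linear_compose[OF T_bl J_bl]
          bounded_linear_compose[OF J_bl R_bl])
    have commutator: "norm (T (J v) - J (?R v)) \<le> \<eta> * norm v" for v
      using onorm[OF comm_bl, of v] mult_right_mono[OF comm norm_ge_zero[of v]] by linarith
    have upper: "m * norm (J (g n)) \<le> \<eta> * norm (g n) + K * norm (e n)" for n
    proof -
      have "m * norm (J (g n)) \<le> norm (T (J (g n)) - r *\<^sub>R J (g n))"
        using w_low[of "J (g n)"] by (simp add: m_def scaleC_of_real)
      \<comment> \<open>Uses R (g n) - r g n = R (e n).\<close>
      also have "T (J (g n)) - r *\<^sub>R J (g n) = (T (J (g n)) - J (?R (g n))) + J (?R (e n))"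
        using R_bl J_bl by (simp add: e_def g_def linear_simps)
      also have "norm \<dots> \<le> norm (T (J (g n)) - J (?R (g n))) + norm (J (?R (e n)))"
        by (rule norm_triangle_ineq)
      also have "norm (T (J (g n)) - J (?R (g n))) \<le> \<eta> * norm (g n)"
        by (rule commutator)
      also have "norm (J (?R (e n))) \<le> norm (?R (e n)) * K"
        by (rule K)
      also have "\<dots> \<le> norm (e n) * K"
        using K norm_resolvent_le by (intro mult_right_mono) auto
      finally show ?thesis
        by (simp add: mult.commute)
    qed
    have lower: "\<kappa> * (norm (g n))\<^sup>2 \<le> \<mu> * (norm (J (g n)))\<^sup>2 + norm (e n) * norm (g n)" for n
    proof -
      define G where "G = (norm (g n))\<^sup>2"
      define E where "E = norm (e n) * norm (g n)"
      \<comment> \<open>Replacing r f by g - e bounds r a[g, g] by G + E once the term -r G is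
        dropped; then \<nu> < r (1 - \<kappa>) allows division by r.\<close>
      have "r *\<^sub>R f n = g n - e n"
        by (simp add: e_def g_def)
      then have "r * Re (cinner (f n) (g n)) = Re (cinner (g n - e n) (g n))"
        using cinner_scaleR_left[of r "f n" "g n"] by simp
      also have "\<dots> \<le> G + E"
        using abs_Re_cinner_le[of "e n" "g n"] by (simp add: cinner_diff_left cinner_self G_def E_def)
      finally have rfg: "r * Re (cinner (f n) (g n)) \<le> G + E" .
      have "Re (a (g n) (g n)) = Re (cinner (f n) (g n)) - G"
        using Re_form_resolvent[of "f n"] by (simp add: g_def G_def)
      then have "r * Re (a (g n) (g n)) = r * Re (cinner (f n) (g n)) - r * G"
        by (simp only: right_diff_distrib)
      also have "\<dots> \<le> (1 - r) * G + E"
        using rfg by (simp add: algebra_simps)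
      also have "\<dots> \<le> G + E"
        using \<open>0 < r\<close> by (simp add: G_def algebra_simps)
      finally have "\<nu> * (r * Re (a (g n) (g n))) \<le> \<nu> * (G + E)"
        using pos by (intro mult_left_mono)
      also have "\<dots> \<le> (r * (1 - \<kappa>)) * (G + E)"
        using \<nu> by (intro mult_right_mono) (auto simp: G_def E_def)
      finally have "\<nu> * Re (a (g n) (g n)) \<le> (1 - \<kappa>) * (G + E)"
        using \<open>0 < r\<close> by (simp add: mult_ac)
      also have "\<dots> \<le> (1 - \<kappa>) * G + E"
        using pos by (simp add: distrib_left E_def mult_left_le_one_le)
      finally show ?thesis
        using J_low[OF gD[of n]] unfolding G_def E_def by (simp add: algebra_simps)
    qed
    \<comment> \<open>Eliminates the norm of J (g n) between \<open>upper\<close> and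
      \<open>lower\<close>, leaving only quantities with known limits.\<close>
    have combined: "m\<^sup>2 * (\<kappa> * (norm (g n))\<^sup>2)
        \<le> \<mu> * (\<eta> * norm (g n) + K * norm (e n))\<^sup>2 + m\<^sup>2 * (norm (e n) * norm (g n))" for n
    proof -
      have "m\<^sup>2 * (\<kappa> * (norm (g n))\<^sup>2)
          \<le> m\<^sup>2 * (\<mu> * (norm (J (g n)))\<^sup>2 + norm (e n) * norm (g n))"
        by (intro mult_left_mono lower) simp
      also have "\<dots> = \<mu> * (m * norm (J (g n)))\<^sup>2 + m\<^sup>2 * (norm (e n) * norm (g n))"
        by (simp add: power_mult_distrib algebra_simps)
      also have "\<mu> * (m * norm (J (g n)))\<^sup>2 \<le> \<mu> * (\<eta> * norm (g n) + K * norm (e n))\<^sup>2"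
        using pos by (intro mult_left_mono power_mono upper) (auto simp: m_def)
      finally show ?thesis by simp
    qed
    have g_lim: "(\<lambda>n. norm (g n)) \<longlonglongrightarrow> r"
    proof -
      have "(\<lambda>n. norm (g n) - r) \<longlonglongrightarrow> 0"
      proof (rule Lim_null_comparison[OF _ e])
        show "\<forall>\<^sub>F n in sequentially. norm (norm (g n) - r) \<le> norm (e n)"
          using norm_triangle_ineq3[of "g _" "r *\<^sub>R f _"] \<open>0 < r\<close>
          by (intro always_eventually allI) (simp add: e_def g_def f)
      qed
      then show ?thesis by (simp add: LIM_zero_iff)
    qed
    have "m\<^sup>2 * (\<kappa> * r\<^sup>2) \<le> \<mu> * (\<eta> * r + K * 0)\<^sup>2 + m\<^sup>2 * (0 * r)"
    proof (rule LIMSEQ_le)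
      show "(\<lambda>n. m\<^sup>2 * (\<kappa> * (norm (g n))\<^sup>2)) \<longlonglongrightarrow> m\<^sup>2 * (\<kappa> * r\<^sup>2)"
        by (intro tendsto_intros g_lim)
      show "(\<lambda>n. \<mu> * (\<eta> * norm (g n) + K * norm (e n))\<^sup>2 + m\<^sup>2 * (norm (e n) * norm (g n)))
          \<longlonglongrightarrow> \<mu> * (\<eta> * r + K * 0)\<^sup>2 + m\<^sup>2 * (0 * r)"
        by (intro tendsto_intros g_lim e)
    qed (use combined in blast)
    \<comment> \<open>The common factor r^2 is positive and cancels.\<close>
    then have "m\<^sup>2 * \<kappa> \<le> \<mu> * \<eta>\<^sup>2"
      using \<open>0 < r\<close> by (simp add: power_mult_distrib)
    then have "m\<^sup>2 \<le> \<eta>\<^sup>2 * (\<mu> / \<kappa>)"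
      using pos by (simp add: field_simps)
    then have "m \<le> sqrt (\<eta>\<^sup>2 * (\<mu> / \<kappa>))"
      by (rule real_le_rsqrt)
    also have "\<dots> = \<eta> * sqrt (\<mu> / \<kappa>)"
      using pos(1) by (simp only: real_sqrt_mult real_sqrt_abs abs_of_nonneg)
    finally show ?thesis
      using w by (intro that[of w]) (auto simp: m_def)
  qed
qed

lemma hausdorff_dist_leI:
  assumes "\<And>x. x \<in> X \<Longrightarrow> \<exists>y\<in>Y. dist x y \<le> d" and "\<And>y. y \<in> Y \<Longrightarrow> \<exists>x\<in>X. dist y x \<le> d"
  shows "hausdorff_dist X Y \<le> ennreal d"
  unfolding hausdorff_dist_def
proof (intro max.boundedI SUP_least)
  fix x assume "x \<in> X"
  then obtain y where "y \<in> Y" "dist x y \<le> d"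
    using assms(1) by blast
  then show "(INF y\<in>Y. ennreal (dist x y)) \<le> ennreal d"
    by (intro INF_lower2[of y] ennreal_leI)
next
  fix y assume "y \<in> Y"
  then obtain x where "x \<in> X" "dist y x \<le> d"
    using assms(2) by blast
  then show "(INF x\<in>X. ennreal (dist y x)) \<le> ennreal d"
    by (intro INF_lower2[of x] ennreal_leI)
qed

theorem theorem3p5:
  fixes D :: "'h::chilbert_space set" and a :: "'h \<Rightarrow> 'h \<Rightarrow> complex"
    and D' :: "'k::chilbert_space set" and a' :: "'k \<Rightarrow> 'k \<Rightarrow> complex"
    and J :: "'h \<Rightarrow> 'k" and J' :: "'k \<Rightarrow> 'h"
    and R :: "'h \<Rightarrow> 'h" and R' :: "'k \<Rightarrow> 'k"
    and \<eta> \<mu> \<nu> \<eta>' \<mu>' \<nu>' \<kappa> \<kappa>' :: real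
  assumes "sesquilinear_form D a" "densely_defined D" "nonneg_form D a" "closed_form D a"
    and "sesquilinear_form D' a'" "densely_defined D'" "nonneg_form D' a'" "closed_form D' a'"
    and "unbounded_on (assoc_dom D a) (assoc_op D a)"
    and "unbounded_on (assoc_dom D' a') (assoc_op D' a')"
    and "R = resolvent D a" and "R' = resolvent D' a'"
    and "bounded_clinear J" and "bounded_clinear J'"
    and "\<eta> > 0" "\<mu> > 0" "\<nu> > 0" "\<eta>' > 0" "\<mu>' > 0" "\<nu>' > 0"
    and "onorm (\<lambda>f. R' (J f) - J (R f)) \<le> \<eta>"
    and "onorm (\<lambda>u. J' (R' u) - R (J' u)) \<le> \<eta>'"
    and "\<forall>f\<in>D. (norm f)\<^sup>2 \<le> \<mu> * (norm (J f))\<^sup>2 + \<nu> * Re (a f f)"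
    and "\<forall>u\<in>D'. (norm u)\<^sup>2 \<le> \<mu>' * (norm (J' u))\<^sup>2 + \<nu>' * Re (a' u u)"
    and "0 < \<kappa>" "\<kappa> < 1" "0 < \<kappa>'" "\<kappa>' < 1"
  shows "hausdorff_dist (spectrum R) (spectrum R') \<le>
    ennreal (Max {\<eta> * sqrt (\<mu> / \<kappa>), \<nu> / (1 - \<kappa>), \<eta>' * sqrt (\<mu>' / \<kappa>'), \<nu>' / (1 - \<kappa>')})"
proof (rule hausdorff_dist_leI)
  interpret A: nonneg_closed_form D a
    using assms by unfold_locales
  interpret A': nonneg_closed_form D' a'
    using assms by unfold_locales
  have R: "selfadjoint R" "0 \<in> spectrum R"
    using assms(9,11) A.zero_in_spectrum_resolvent
    by (auto simp: selfadjoint_def A.resolvent_bounded_clinear A.resolvent_selfadjoint)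
  have R': "selfadjoint R'" "0 \<in> spectrum R'"
    using assms(10,12) A'.zero_in_spectrum_resolvent
    by (auto simp: selfadjoint_def A'.resolvent_bounded_clinear A'.resolvent_selfadjoint)
  {
    fix z assume "z \<in> spectrum R"
    then obtain w where "w \<in> spectrum R'" "dist z w \<le> max (\<eta> * sqrt (\<mu> / \<kappa>)) (\<nu> / (1 - \<kappa>))"
      using A.spectrum_resolvent_near[OF R', of J \<eta> \<mu> \<nu> \<kappa> z] assms by auto
    then show "\<exists>w\<in>spectrum R'. dist z w
        \<le> Max {\<eta> * sqrt (\<mu> / \<kappa>), \<nu> / (1 - \<kappa>), \<eta>' * sqrt (\<mu>' / \<kappa>'), \<nu>' / (1 - \<kappa>')}"
      by (intro bexI[of _ w]) (auto simp: max_def split: if_splits)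
  next
    \<comment> \<open>With the roles exchanged, the comparison lemma expects the commutator with the
      opposite sign.\<close>
    have "onorm (\<lambda>u. R (J' u) - J' (R' u)) \<le> \<eta>'"
      using assms(22) onorm_neg[of "\<lambda>u. J' (R' u) - R (J' u)"] by simp
    moreover fix z assume "z \<in> spectrum R'"
    ultimately obtain w where "w \<in> spectrum R" "dist z w \<le> max (\<eta>' * sqrt (\<mu>' / \<kappa>')) (\<nu>' / (1 - \<kappa>'))"
      using A'.spectrum_resolvent_near[OF R, of J' \<eta>' \<mu>' \<nu>' \<kappa>' z] assms by auto
    then show "\<exists>w\<in>spectrum R. dist z w
        \<le> Max {\<eta> * sqrt (\<mu> / \<kappa>), \<nu> / (1 - \<kappa>), \<eta>' * sqrt (\<mu>' / \<kappa>'), \<nu>' / (1 - \<kappa>')}"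
      by (intro bexI[of _ w]) (auto simp: max_def split: if_splits)
  }
qed

end
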